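(* Let $m\geq 1$ and let $\lambda=(\lambda_1,\dots,\lambda_m)$, $\lambda_1\geq\cdots\geq\lambda_m\geq 0$, be a partition with exactly $\ell\leq m$ nonzero parts. Let $V=\mathbb{C}^m$, let $N=\dim \mathbb{S}_\lambda(V)$, and let $G=\mathbb{S}_\lambda(\mathrm{SL}_m)\leq \mathrm{GL}_N$ denote the image of $\mathrm{SL}_m$ under the representation $\mathbb{S}_\lambda:\mathrm{SL}_m\to\mathrm{GL}(\mathbb{S}_\lambda(V))\cong\mathrm{GL}_N$. If $m>3\ell$, then the representation $\otimes^3:\mathrm{GL}_N\to\mathrm{GL}((\mathbb{C}^N)^{\otimes 3})$ does not detect $G$.
   Context: All groups are complex algebraic groups. $\mathbb{S}_\lambda$ denotes the Schur functor attached to the partition $\lambda$. For a subgroup $G\leq\mathrm{GL}_N$ and a representation $r:\mathrm{GL}_N\to\mathrm{GL}(V_r)$, one says $r$ detects $G$ if $G$ fixes a line in $V_r$ (i.e., $r(G)$ preserves some one-dimensional subspace of $V_r$).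
   Formalization: The formal theorem adds ℓ ≥ 1 (λ nonzero); for ℓ = 0 the claim is false, since then 𝕊_λ(V) = ℂ is trivial, N = 1, G = {1}, and G fixes the line (ℂ^1)^{⊗3} although m > 0 = 3ℓ. *)

theory Defs
  imports
    "HOL-Library.Function_Algebras"
    "HOL-Combinatorics.Permutations"
    "Jordan_Normal_Form.Determinant"
begin

section \<open>Complex vector spaces of functions\<close>

definition fscale :: "complex \<Rightarrow> ('i \<Rightarrow> complex) \<Rightarrow> 'i \<Rightarrow> complex" where
  "fscale c f = (\<lambda>x. c * f x)"

global_interpretation cfun: vector_space "fscale :: complex \<Rightarrow> ('i \<Rightarrow> complex) \<Rightarrow> 'i \<Rightarrow> complex"
  by unfold_locales (auto simp: fscale_def fun_eq_iff algebra_simps)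

definition ordered_basis :: "('i \<Rightarrow> complex) list \<Rightarrow> ('i \<Rightarrow> complex) set \<Rightarrow> bool" where
  "ordered_basis bs S \<longleftrightarrow> distinct bs \<and> cfun.independent (set bs) \<and> cfun.span (set bs) = S"

definition matrix_wrt :: "('i \<Rightarrow> complex) list \<Rightarrow> (('i \<Rightarrow> complex) \<Rightarrow> 'i \<Rightarrow> complex) \<Rightarrow> complex mat" where
  "matrix_wrt bs f =
     mat (length bs) (length bs) (\<lambda>(i, j). cfun.representation (set bs) (f (bs ! j)) (bs ! i))"


section \<open>Linear groups and detection\<close>

definition GL :: "nat \<Rightarrow> complex mat set" where
  "GL n = {A \<in> carrier_mat n n. invertible_mat A}"

definition SL :: "nat \<Rightarrow> complex mat set" where
  "SL n = {A \<in> carrier_mat n n. det A = 1}"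

text \<open>
  Here \<open>r\<close> is the representation, on the space \<open>W\<close>, of an ambient general linear group
  that contains \<open>G\<close>.
\<close>

definition detects ::
  "(complex mat \<Rightarrow> ('i \<Rightarrow> complex) \<Rightarrow> 'i \<Rightarrow> complex) \<Rightarrow> ('i \<Rightarrow> complex) set \<Rightarrow> complex mat set \<Rightarrow> bool"
  where "detects r W G \<longleftrightarrow>
    (\<exists>L. L \<subseteq> W \<and> cfun.subspace L \<and> cfun.dim L = 1 \<and> (\<forall>g\<in>G. r g ` L \<subseteq> L))"


section \<open>Tensor powers\<close>

text \<open>
  The \<open>k\<close>-th tensor power of $\mathbb{C}^n$ has the basis of pure tensors
  $e_{w_0} \otimes \dots \otimes e_{w_{k-1}}$ indexed by words \<open>w\<close> of length \<open>k\<close> in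
  the letters \<open>0, \<dots>, n - 1\<close>. A tensor is its coefficient function, extended by \<open>0\<close>
  to all other lists.
\<close>

type_synonym tensor = "nat list \<Rightarrow> complex"

definition words :: "nat \<Rightarrow> nat \<Rightarrow> nat list set" where
  "words n k = {w. length w = k \<and> set w \<subseteq> {..<n}}"

definition tensor_space :: "nat \<Rightarrow> nat \<Rightarrow> tensor set" where
  "tensor_space n k = {T. \<forall>w. w \<notin> words n k \<longrightarrow> T w = 0}"

definition tensor_power :: "nat \<Rightarrow> complex mat \<Rightarrow> tensor \<Rightarrow> tensor" where
  "tensor_power k A T = (\<lambda>w.
     if w \<in> words (dim_row A) k
     then \<Sum>u\<in>words (dim_col A) k. (\<Prod>i<k. A $$ (w ! i, u ! i)) * T u
     else 0)"


section \<open>Schur functors\<close>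

text \<open>
  A partition is a weakly decreasing list \<open>lam\<close> of naturals, trailing zeros allowed. The boxes
  \<open>(row, column)\<close> of its Young diagram are numbered by \<open>0, \<dots>, sum_list lam - 1\<close>
  in reading order.
\<close>

definition boxes :: "nat list \<Rightarrow> (nat \<times> nat) list" where
  "boxes lam = concat (map (\<lambda>i. map (Pair i) [0..<lam ! i]) [0..<length lam])"

definition row_group :: "nat list \<Rightarrow> (nat \<Rightarrow> nat) set" where
  "row_group lam = {p. p permutes {..<sum_list lam} \<and>
     (\<forall>k<sum_list lam. fst (boxes lam ! p k) = fst (boxes lam ! k))}"

definition col_group :: "nat list \<Rightarrow> (nat \<Rightarrow> nat) set" where
  "col_group lam = {p. p permutes {..<sum_list lam} \<and>
     (\<forall>k<sum_list lam. snd (boxes lam ! p k) = snd (boxes lam ! k))}"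

text \<open>
  The left action of the symmetric group on tensors by permuting the factors: it moves the
  factor at position \<open>i\<close> to position \<open>p i\<close>. On coefficients this is precomposition
  with \<open>permute_list p\<close>, which sends a word \<open>w\<close> to the word with letters \<open>w ! p i\<close>.
\<close>

definition permute_tensor :: "nat \<Rightarrow> (nat \<Rightarrow> nat) \<Rightarrow> tensor \<Rightarrow> tensor" where
  "permute_tensor k p T = (\<lambda>w. if length w = k then T (permute_list p w) else 0)"

text \<open>
  The Young symmetrizer $c_\lambda = a_\lambda b_\lambda = \sum_{p, q} \mathrm{sgn}(q)\, p q$
  (\<open>p\<close> in the row group, \<open>q\<close> in the column group), acting on tensors; its image on
  the tensor power of $V = \mathbb{C}^m$ is $\mathbb{S}_\lambda(V)$.
\<close>

definition young_symmetrizer :: "nat list \<Rightarrow> tensor \<Rightarrow> tensor" where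
  "young_symmetrizer lam T =
     (\<Sum>p\<in>row_group lam. \<Sum>q\<in>col_group lam.
        fscale (of_int (sign q)) (permute_tensor (sum_list lam) (p \<circ> q) T))"

definition schur_space :: "nat list \<Rightarrow> nat \<Rightarrow> tensor set" where
  "schur_space lam m = young_symmetrizer lam ` tensor_space m (sum_list lam)"

text \<open>
  A matrix \<open>A\<close> acts on $\mathbb{S}_\lambda(V)$ by restriction of its tensor power.
  \<open>schur_matrix lam bs A\<close> is the matrix of this restriction in the ordered basis \<open>bs\<close>
  of $\mathbb{S}_\lambda(V)$.
\<close>

definition schur_matrix :: "nat list \<Rightarrow> tensor list \<Rightarrow> complex mat \<Rightarrow> complex mat" where
  "schur_matrix lam bs A = matrix_wrt bs (tensor_power (sum_list lam) A)"


section \<open>Well-definedness\<close>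

text \<open>
  Tensor powers are representations, they preserve Schur functors, and the matrices
  \<open>schur_matrix lam bs A\<close> form a subgroup of the general linear group.
\<close>


lemma words_bij: "bij_betw (\<lambda>g. map g [0..<k]) ({..<k} \<rightarrow>\<^sub>E {..<n}) (words n k)"
proof (rule bij_betw_byWitness[where f' = "\<lambda>w. \<lambda>i\<in>{..<k}. w ! i"])
  show "(\<lambda>g. map g [0..<k]) ` ({..<k} \<rightarrow>\<^sub>E {..<n}) \<subseteq> words n k"
  proof
    fix w assume "w \<in> (\<lambda>g. map g [0..<k]) ` ({..<k} \<rightarrow>\<^sub>E {..<n})"
    then obtain g where g: "g \<in> {..<k} \<rightarrow>\<^sub>E {..<n}" and w: "w = map g [0..<k]"
      by (rule imageE)
    have "g i < n" if "i < k" for i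
      using PiE_mem[OF g, of i] that by simp
    then show "w \<in> words n k"
      by (simp add: w words_def image_subset_iff)
  qed
  show "(\<lambda>w. \<lambda>i\<in>{..<k}. w ! i) ` words n k \<subseteq> {..<k} \<rightarrow>\<^sub>E {..<n}"
  proof
    fix g assume "g \<in> (\<lambda>w. \<lambda>i\<in>{..<k}. w ! i) ` words n k"
    then obtain w where w: "w \<in> words n k" and g: "g = (\<lambda>i\<in>{..<k}. w ! i)"
      by (rule imageE)
    have "w ! i \<in> {..<n}" if "i \<in> {..<k}" for i
      using w that by (intro subsetD[of "set w" "{..<n}"] nth_mem) (simp_all add: words_def)
    then show "g \<in> {..<k} \<rightarrow>\<^sub>E {..<n}" unfolding g by (rule restrict_PiE_iff[THEN iffD2, rule_format])
  qed
  show "\<forall>g\<in>{..<k} \<rightarrow>\<^sub>E {..<n}. (\<lambda>i\<in>{..<k}. map g [0..<k] ! i) = g"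
  proof
    fix g assume g: "g \<in> {..<k} \<rightarrow>\<^sub>E {..<n}"
    show "(\<lambda>i\<in>{..<k}. map g [0..<k] ! i) = g"
    proof
      fix i show "(\<lambda>i\<in>{..<k}. map g [0..<k] ! i) i = g i"
        using PiE_arb[OF g, of i] by (cases "i < k") simp_all
    qed
  qed
  show "\<forall>w\<in>words n k. map (\<lambda>i\<in>{..<k}. w ! i) [0..<k] = w"
    by (simp add: words_def list_eq_iff_nth_eq)
qed

lemma finite_words [simp]: "finite (words n k)"
  using bij_betw_finite[OF words_bij[of k n]] by (auto intro: finite_PiE)

lemma words_nth: "w \<in> words n k \<Longrightarrow> i < k \<Longrightarrow> w ! i < n"
  unfolding words_def by (auto dest!: subsetD[OF _ nth_mem])

lemma prod_sum_words:
  fixes f :: "nat \<Rightarrow> nat \<Rightarrow> complex"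
  shows "(\<Prod>i<k. \<Sum>j<n. f i j) = (\<Sum>v\<in>words n k. \<Prod>i<k. f i (v ! i))"
  by (subst sum.reindex_bij_betw[OF words_bij, symmetric]) (simp add: prod_sum_PiE)

lemma tensor_power_mult:
  assumes A: "A \<in> carrier_mat n p" and B: "B \<in> carrier_mat p r"
  shows "tensor_power k (A * B) T = tensor_power k A (tensor_power k B T)"
proof
  fix w
  show "tensor_power k (A * B) T w = tensor_power k A (tensor_power k B T) w"
  proof (cases "w \<in> words n k")
    case False then show ?thesis using A B by (simp add: tensor_power_def)
  next
    case w: True
    have *: "(\<Prod>i<k. (A * B) $$ (w ! i, u ! i)) =
       (\<Sum>v\<in>words p k. (\<Prod>i<k. A $$ (w ! i, v ! i)) * (\<Prod>i<k. B $$ (v ! i, u ! i)))"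
      if u: "u \<in> words r k" for u
    proof -
      have "(\<Prod>i<k. (A * B) $$ (w ! i, u ! i)) = (\<Prod>i<k. \<Sum>j<p. A $$ (w ! i, j) * B $$ (j, u ! i))"
        using words_nth[OF w] words_nth[OF u] A B
        by (intro prod.cong) (auto simp: scalar_prod_def atLeast0LessThan)
      then show ?thesis by (simp add: prod_sum_words prod.distrib)
    qed
    have "tensor_power k (A * B) T w = (\<Sum>u\<in>words r k. \<Sum>v\<in>words p k.
        (\<Prod>i<k. A $$ (w ! i, v ! i)) * (\<Prod>i<k. B $$ (v ! i, u ! i)) * T u)"
      using w A B by (simp add: tensor_power_def * sum_distrib_right)
    also have "\<dots> = (\<Sum>v\<in>words p k. \<Sum>u\<in>words r k. 
        (\<Prod>i<k. A $$ (w ! i, v ! i)) * (\<Prod>i<k. B $$ (v ! i, u ! i)) * T u)"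
      by (rule sum.swap)
    also have "\<dots> = tensor_power k A (tensor_power k B T) w"
      using w A B by (simp add: tensor_power_def sum_distrib_left mult.assoc)
    finally show ?thesis .
  qed
qed

lemma tensor_power_one:
  assumes "T \<in> tensor_space n k"
  shows "tensor_power k (1\<^sub>m n) T = T"
proof
  fix w
  show "tensor_power k (1\<^sub>m n) T w = T w"
  proof (cases "w \<in> words n k")
    case False then show ?thesis using assms by (simp add: tensor_power_def tensor_space_def)
  next
    case w: True
    have "(\<Prod>i<k. 1\<^sub>m n $$ (w ! i, u ! i)) = (if u = w then 1 else 0 :: complex)"
      if u: "u \<in> words n k" for u
    proof (cases "u = w")
      case True then show ?thesis using words_nth[OF w] by simp
    next
      case False
      then obtain i where "i < k" "u ! i \<noteq> w ! i"
        using u w unfolding words_def by (auto simp: list_eq_iff_nth_eq)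
      then show ?thesis using False words_nth[OF w] words_nth[OF u]
        by (auto intro!: prod_zero bexI[of _ i])
    qed
    then have "tensor_power k (1\<^sub>m n) T w = (\<Sum>u\<in>words n k. (if u = w then 1 else 0) * T u)"
      using w by (simp add: tensor_power_def)
    also have "\<dots> = (\<Sum>u\<in>words n k. if u = w then T u else 0)"
      by (intro sum.cong) auto
    finally have "tensor_power k (1\<^sub>m n) T w = (\<Sum>u\<in>words n k. if u = w then T u else 0)" .
    then show ?thesis using w by simp
  qed
qed

lemma tensor_power_in: "A \<in> carrier_mat n p \<Longrightarrow> tensor_power k A T \<in> tensor_space n k"
  by (auto simp: tensor_power_def tensor_space_def)

lemma tensor_power_linear: "Vector_Spaces.linear fscale fscale (tensor_power k A)"
  by unfold_locales
    (auto simp: tensor_power_def fscale_def fun_eq_iff sum_distrib_left sum.distrib algebra_simps)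

lemma perm_words: "p permutes {..<k} \<Longrightarrow> length w = k \<Longrightarrow> permute_list p w \<in> words n k \<longleftrightarrow> w \<in> words n k"
  by (auto simp: words_def)

lemma permute_tensor_power:
  assumes p: "p permutes {..<k}"
  shows "permute_tensor k p (tensor_power k A T) = tensor_power k A (permute_tensor k p T)"
proof
  fix w
  let ?n = "dim_row A" and ?m = "dim_col A"
  show "permute_tensor k p (tensor_power k A T) w = tensor_power k A (permute_tensor k p T) w"
  proof (cases "w \<in> words ?n k")
    case False
    then show ?thesis using p
      by (simp add: permute_tensor_def tensor_power_def perm_words)
  next
    case w: True
    then have lw: "length w = k" by (simp add: words_def)
    have bij: "bij_betw (permute_list p) (words ?m k) (words ?m k)"
    proof (rule bij_betw_byWitness[where f' = "permute_list (inv_into UNIV p)"])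
      have "permute_list (inv_into UNIV p) (permute_list p a) = a \<and> permute_list p (permute_list (inv_into UNIV p) a) = a"
        if "length a = k" for a :: "nat list"
        using that p permutes_inv[OF p] 
        by (simp flip: permute_list_compose add: permutes_inv_o)
      then show "\<forall>a\<in>words ?m k. permute_list (inv_into UNIV p) (permute_list p a) = a"
        "\<forall>a\<in>words ?m k. permute_list p (permute_list (inv_into UNIV p) a) = a"
        by (auto simp: words_def)
    qed (use p permutes_inv[OF p] in \<open>auto simp: words_def\<close>)
    have "permute_tensor k p (tensor_power k A T) w =
       (\<Sum>u\<in>words ?m k. (\<Prod>i<k. A $$ (w ! p i, u ! i)) * T u)"
      using w lw p
      by (auto simp: permute_tensor_def tensor_power_def perm_words permute_list_nth intro!: sum.cong prod.cong)
    also have "\<dots> = (\<Sum>u\<in>words ?m k. (\<Prod>i<k. A $$ (w ! p i, permute_list p u ! i)) * T (permute_list p u))"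
      by (rule sum.reindex_bij_betw[OF bij, symmetric])
    also have "\<dots> = (\<Sum>u\<in>words ?m k. (\<Prod>i<k. A $$ (w ! i, u ! i)) * T (permute_list p u))"
    proof (rule sum.cong[OF refl])
      fix u assume u: "u \<in> words ?m k"
      have "(\<Prod>i<k. A $$ (w ! p i, permute_list p u ! i)) = (\<Prod>i<k. A $$ (w ! p i, u ! p i))"
        using u p by (intro prod.cong) (auto simp: words_def permute_list_nth)
      also have "\<dots> = (\<Prod>i<k. A $$ (w ! i, u ! i))"
        using prod.reindex_bij_betw[OF permutes_imp_bij[OF p], of "\<lambda>i. A $$ (w ! i, u ! i)"] by simp
      finally show "(\<Prod>i<k. A $$ (w ! p i, permute_list p u ! i)) * T (permute_list p u) =
         (\<Prod>i<k. A $$ (w ! i, u ! i)) * T (permute_list p u)" by simp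
    qed
    also have "\<dots> = tensor_power k A (permute_tensor k p T) w"
      using w by (auto simp: tensor_power_def permute_tensor_def words_def intro!: sum.cong)
    finally show ?thesis .
  qed
qed

lemma young_tensor_power:
  "young_symmetrizer lam (tensor_power (sum_list lam) A T) =
   tensor_power (sum_list lam) A (young_symmetrizer lam T)"
proof -
  interpret l: Vector_Spaces.linear fscale fscale "tensor_power (sum_list lam) A"
    by (rule tensor_power_linear)
  show ?thesis
    unfolding young_symmetrizer_def l.sum l.scale
    by (intro sum.cong refl arg_cong[where f = "fscale _"] permute_tensor_power)
      (auto simp: row_group_def col_group_def intro: permutes_compose)
qed

lemma schur_space_invariant:
  assumes "A \<in> carrier_mat m m" "T \<in> schur_space lam m"
  shows "tensor_power (sum_list lam) A T \<in> schur_space lam m"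
  using assms tensor_power_in[OF assms(1)] unfolding schur_space_def
  by (auto simp flip: young_tensor_power)

lemma schur_space_subset: "schur_space lam m \<subseteq> tensor_space m (sum_list lam)"
proof -
  have "permute_tensor k p T \<in> tensor_space m k" if "p permutes {..<k}" "T \<in> tensor_space m k" for k p T
    using that perm_words[of p k _ m] by (auto simp: tensor_space_def permute_tensor_def)
  moreover have "p \<circ> q permutes {..<sum_list lam}" if "p \<in> row_group lam" "q \<in> col_group lam" for p q
    using that by (auto simp: row_group_def col_group_def intro: permutes_compose)
  moreover have "cfun.subspace (tensor_space m k)" for k
    unfolding cfun.subspace_def by (auto simp: tensor_space_def fscale_def)
  ultimately show ?thesis unfolding schur_space_def young_symmetrizer_def
    by (auto intro!: cfun.subspace_sum cfun.subspace_scale simp del: o_apply)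
qed

lemma schur_matrix_mult:
  assumes bs: "ordered_basis bs (schur_space lam m)"
    and A: "A \<in> carrier_mat m m" and B: "B \<in> carrier_mat m m"
  shows "schur_matrix lam bs (A * B) = schur_matrix lam bs A * schur_matrix lam bs B"
proof -
  let ?d = "sum_list lam" and ?S = "schur_space lam m" and ?R = "cfun.representation (set bs)"
  interpret l: Vector_Spaces.linear fscale fscale "tensor_power ?d A" by (rule tensor_power_linear)
  have ind: "cfun.independent (set bs)" and sp: "cfun.span (set bs) = ?S" and d: "distinct bs"
    using bs by (auto simp: ordered_basis_def)
  have nth: "bs ! j \<in> ?S" if "j < length bs" for j
    using that sp cfun.span_base by (metis nth_mem)
  show ?thesis
  proof (rule eq_matI)
    fix i j assume "i < dim_row (schur_matrix lam bs A * schur_matrix lam bs B)"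
      "j < dim_col (schur_matrix lam bs A * schur_matrix lam bs B)"
    then have i: "i < length bs" and j: "j < length bs" by (auto simp: schur_matrix_def matrix_wrt_def)
    let ?x = "tensor_power ?d B (bs ! j)"
    have x: "?x \<in> ?S" by (rule schur_space_invariant[OF B nth[OF j]])
    have "?x = (\<Sum>b\<in>set bs. fscale (?R ?x b) b)"
      using cfun.sum_representation_eq[OF ind, of ?x "set bs"] x sp by simp
    also have "\<dots> = (\<Sum>k<length bs. fscale (?R ?x (bs ! k)) (bs ! k))"
      using sum.reindex_bij_betw[OF bij_betw_nth[OF d refl refl], of "\<lambda>b. fscale (?R ?x b) b"] by simp
    finally have "tensor_power ?d A ?x = tensor_power ?d A (\<Sum>k<length bs. fscale (?R ?x (bs ! k)) (bs ! k))" by simp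
    also have "\<dots> = (\<Sum>k<length bs. fscale (?R ?x (bs ! k)) (tensor_power ?d A (bs ! k)))"
      by (simp add: l.sum l.scale)
    finally have *: "tensor_power ?d A ?x = (\<Sum>k<length bs. fscale (?R ?x (bs ! k)) (tensor_power ?d A (bs ! k)))" .
    have Ak: "tensor_power ?d A (bs ! k) \<in> cfun.span (set bs)" if "k < length bs" for k
      using schur_space_invariant[OF A nth[OF that]] sp by simp
    have "?R (tensor_power ?d A ?x) (bs ! i) =
       (\<Sum>k<length bs. ?R (fscale (?R ?x (bs ! k)) (tensor_power ?d A (bs ! k))) (bs ! i))"
      unfolding * using Ak by (subst cfun.representation_sum[OF ind]) (auto intro: cfun.span_scale)
    also have "\<dots> = (\<Sum>k<length bs. ?R ?x (bs ! k) * ?R (tensor_power ?d A (bs ! k)) (bs ! i))"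
      using Ak by (intro sum.cong) (auto simp: cfun.representation_scale[OF ind])
    finally show "schur_matrix lam bs (A * B) $$ (i, j) = (schur_matrix lam bs A * schur_matrix lam bs B) $$ (i, j)"
      using i j by (simp add: schur_matrix_def matrix_wrt_def tensor_power_mult[OF A B] scalar_prod_def
          atLeast0LessThan mult.commute)
  qed (auto simp: schur_matrix_def matrix_wrt_def)
qed

lemma schur_matrix_one:
  assumes bs: "ordered_basis bs (schur_space lam m)"
  shows "schur_matrix lam bs (1\<^sub>m m) = 1\<^sub>m (length bs)"
proof (rule eq_matI)
  fix i j assume "i < dim_row (1\<^sub>m (length bs) :: complex mat)" "j < dim_col (1\<^sub>m (length bs) :: complex mat)"
  then have i: "i < length bs" and j: "j < length bs" by auto
  have ind: "cfun.independent (set bs)" and sp: "cfun.span (set bs) = schur_space lam m" and d: "distinct bs"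
    using bs by (auto simp: ordered_basis_def)
  have "bs ! j \<in> tensor_space m (sum_list lam)"
    using j sp cfun.span_base schur_space_subset by (metis nth_mem subsetD)
  then show "schur_matrix lam bs (1\<^sub>m m) $$ (i, j) = 1\<^sub>m (length bs) $$ (i, j)"
    using i j d by (simp add: schur_matrix_def matrix_wrt_def tensor_power_one
       cfun.representation_basis[OF ind] nth_eq_iff_index_eq)
qed (auto simp: schur_matrix_def matrix_wrt_def)

lemma length_ordered_basis:
  assumes "ordered_basis bs S"
  shows "length bs = cfun.dim S"
  using assms cfun.dim_eq_card[of "set bs" S]
  by (auto simp: ordered_basis_def distinct_card cfun.span_span)

lemma schur_matrix_GL:
  assumes bs: "ordered_basis bs (schur_space lam m)" and A: "A \<in> GL m"
  shows "schur_matrix lam bs A \<in> GL (cfun.dim (schur_space lam m))"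
proof -
  let ?n = "length bs"
  have A': "A \<in> carrier_mat m m" using A by (simp add: GL_def)
  obtain B where "inverts_mat A B" "inverts_mat B A"
    using A by (auto simp: GL_def invertible_mat_def)
  then have B: "A * B = 1\<^sub>m m" "B * A = 1\<^sub>m (dim_row B)" 
    using A' by (auto simp: inverts_mat_def)
  have Bc: "B \<in> carrier_mat m m"
    using arg_cong[OF B(1), of dim_col] arg_cong[OF B(2), of dim_col] A' by auto
  have C: "schur_matrix lam bs X \<in> carrier_mat ?n ?n" for X
    by (simp add: schur_matrix_def matrix_wrt_def)
  have B2: "B * A = 1\<^sub>m m" using B(2) Bc by simp
  have "schur_matrix lam bs A * schur_matrix lam bs B = 1\<^sub>m ?n"
    unfolding schur_matrix_mult[OF bs A' Bc, symmetric] B(1) by (rule schur_matrix_one[OF bs])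
  moreover have "schur_matrix lam bs B * schur_matrix lam bs A = 1\<^sub>m ?n"
    unfolding schur_matrix_mult[OF bs Bc A', symmetric] B2 by (rule schur_matrix_one[OF bs])
  ultimately have "invertible_mat (schur_matrix lam bs A)"
    unfolding invertible_mat_def inverts_mat_def square_mat.simps
    using carrier_matD[OF C[of A]] carrier_matD[OF C[of B]] by metis
  then show ?thesis using C[of A] length_ordered_basis[OF bs] by (simp add: GL_def)
qed

lemma SL_subset_GL: "SL m \<subseteq> GL m"
proof
  fix A assume "A \<in> SL m"
  then have A: "A \<in> carrier_mat m m" "det A = 1" by (auto simp: SL_def)
  then obtain B where "B \<in> carrier_mat m m" "B * A = 1\<^sub>m m" "A * B = 1\<^sub>m m"
    using det_non_zero_imp_unit[OF A(1)] by (auto simp: Units_def ring_mat_def)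
  then show "A \<in> GL m" using A by (auto simp: GL_def invertible_mat_def inverts_mat_def)
qed

end

theory Submission
  imports Defs "Jordan_Normal_Form.Char_Poly"
begin

text \<open>
  A tensor in $\mathbb{S}_\lambda(V) \subseteq V^{\otimes d}$ is invariant under the row group, so
  it is determined by its polarized values on \<open>l\<close> covectors, one for each nonzero row. Hence a
  vector \<open>t\<close> of the \<open>k\<close>-th tensor power of $\mathbb{S}_\lambda(V)$ is determined by a
  polynomial in \<open>k * l < m\<close> covectors, that is, in the first \<open>k * l\<close> rows of an
  \<open>m * m\<close> matrix \<open>X\<close>. If \<open>t\<close> spans a line fixed by \<open>SL m\<close>, with character
  \<open>chi\<close>, this polynomial \<open>F\<close> satisfies \<open>F(A) = chi(A) F(1)\<close> on \<open>SL m\<close>. A diagonal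
  matrix \<open>D\<close> with entries \<open>2\<close> at a letter that occurs and \<open>1/2\<close> at the last letter, which
  does not occur, is conjugate to its inverse, so \<open>chi(D) = chi(D\<^sup>-\<^sup>1)\<close>; but
  \<open>F(D) = 2\<^sup>e F(1)\<close> and \<open>F(D\<^sup>-\<^sup>1) = 2\<^sup>-\<^sup>e F(1)\<close> with \<open>e > 0\<close>, so
  \<open>F(1) = 0\<close> and \<open>F\<close> vanishes on \<open>SL m\<close>. As \<open>F\<close> ignores the last row it vanishes on
  all invertible matrices, hence everywhere, and \<open>t = 0\<close>.
\<close>

section \<open>Multilinear forms on a spanning set\<close>

lemma sum_words_Suc:
  fixes f :: "nat list \<Rightarrow> complex"
  shows "(\<Sum>a\<in>words n (Suc k). f a) = (\<Sum>i<n. \<Sum>a\<in>words n k. f (i # a))"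
proof -
  have "bij_betw (\<lambda>(i, a). i # a) ({..<n} \<times> words n k) (words n (Suc k))"
    by (rule bij_betw_byWitness[where f' = "\<lambda>w. (hd w, tl w)"])
      (auto simp: words_def length_Suc_conv)
  from sum.reindex_bij_betw[OF this, of f, symmetric] show ?thesis
    by (simp add: sum.cartesian_product case_prod_beta)
qed

text \<open>The hypothesis \<open>sep\<close> says that no nonzero linear form vanishes on
  \<open>E\<close>. With all arguments but the first frozen, the multilinear form is linear in the
  first one, so \<open>sep\<close> kills each of its coefficients, and these are forms in one
  argument fewer. Nonemptiness of \<open>E\<close> supplies an argument sequence in the case
  \<open>k = 0\<close>.\<close>

lemma multilinear_separation:
  fixes E :: "(nat \<Rightarrow> complex) set"
  assumes "E \<noteq> {}"
    and sep: "\<And>c n. (\<And>x. x \<in> E \<Longrightarrow> (\<Sum>n<N. c n * x n) = 0) \<Longrightarrow> n < N \<Longrightarrow> c n = 0"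
    and zero: "\<And>x. (\<And>i. x i \<in> E) \<Longrightarrow> (\<Sum>a\<in>words N k. t a * (\<Prod>i<k. x i (a ! i))) = 0"
    and "a \<in> words N k"
  shows "t a = 0"
  using zero \<open>a \<in> words N k\<close>
proof (induction k arbitrary: t a)
  case 0
  have "words N 0 = {[]}" by (auto simp: words_def)
  then show ?case using 0 \<open>E \<noteq> {}\<close> by fastforce
next
  case (Suc k)
  obtain n b where a: "a = n # b" "n < N" "b \<in> words N k"
    using Suc.prems(2) by (cases a) (auto simp: words_def)
  show ?case unfolding a(1)
  proof (rule Suc.IH[OF _ a(3)])
    fix x :: "nat \<Rightarrow> nat \<Rightarrow> complex" assume x: "x i \<in> E" for i
    show "(\<Sum>b\<in>words N k. t (n # b) * (\<Prod>i<k. x i (b ! i))) = 0"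
    proof (rule sep[OF _ a(2), of "\<lambda>n. \<Sum>b\<in>words N k. t (n # b) * (\<Prod>i<k. x i (b ! i))"])
      fix y assume "y \<in> E"
      then have "case_nat y x i \<in> E" for i using x by (cases i) auto
      from Suc.prems(1)[of "case_nat y x", OF this]
      show "(\<Sum>n<N. (\<Sum>b\<in>words N k. t (n # b) * (\<Prod>i<k. x i (b ! i))) * y n) = 0"
        by (simp add: sum_words_Suc prod.lessThan_Suc_shift sum_distrib_left sum_distrib_right mult_ac del: prod.lessThan_Suc)
    qed
  qed
qed

section \<open>Polarization of symmetric tensors\<close>

lemma prod_list_map_eq_prod_count:
  fixes g :: "'a \<Rightarrow> complex"
  assumes "set xs \<subseteq> X" "finite X"
  shows "prod_list (map g xs) = (\<Prod>x\<in>X. g x ^ count_list xs x)"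
  using assms(1)
proof (induction xs)
  case (Cons a xs)
  have "(\<Prod>x\<in>X. g x ^ count_list (a # xs) x) =
    (\<Prod>x\<in>X. (if a = x then g x else 1) * g x ^ count_list xs x)"
    by (intro prod.cong) auto
  also have "\<dots> = g a * prod_list (map g xs)"
    using Cons assms(2) by (simp add: prod.distrib prod.delta)
  finally show ?case by simp
qed simp

text \<open>
  Polarization with signs: at the row vectors \<open>Y z\<close> below, the form is a sum over the
  row-preserving self-maps \<open>f\<close> of the positions, and averaging over the signs against their
  product leaves only the bijective \<open>f\<close>, each of which contributes a multiple of \<open>s u\<close>.
\<close>

lemma symmetric_tensor_eq_0:
  fixes r :: "nat \<Rightarrow> nat"
  assumes s: "s \<in> tensor_space m d"
    and sym: "\<And>p u. p permutes {..<d} \<Longrightarrow> (\<And>j. j < d \<Longrightarrow> r (p j) = r j) \<Longrightarrow> u \<in> words m d \<Longrightarrow>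
      s (permute_list p u) = s u"
    and zero: "\<And>Y. (\<Sum>u\<in>words m d. (\<Prod>j<d. Y (r j) (u ! j)) * s u) = 0"
  shows "s = 0"
proof
  fix u
  show "s u = 0 u"
  proof (cases "u \<in> words m d")
    case False
    then show ?thesis using s by (simp add: tensor_space_def)
  next
    case u: True
    define F where "F = {f \<in> words d d. \<forall>j<d. r (f ! j) = r j}"
    have finF: "finite F" by (simp add: F_def)
    \<comment> \<open>The covector of row \<open>i\<close> adds up signed dual vectors of the
      letters of \<open>u\<close> in that row. Expanding the product over the positions chooses, for
      each \<open>j\<close>, a position \<open>f ! j\<close> in the same row.\<close>
    define Y :: "nat list \<Rightarrow> nat \<Rightarrow> nat \<Rightarrow> complex" where
      "Y z i c = (\<Sum>j<d. if r j = i \<and> u ! j = c then (-1) ^ (z ! j) else 0)" for z i c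
    have eval: "(\<Sum>v\<in>words m d. (\<Prod>j<d. Y z (r j) (v ! j)) * s v) =
        (\<Sum>f\<in>F. (\<Prod>j<d. (-1) ^ (z ! (f ! j))) * s (map ((!) u) f))" for z
    proof -
      have *: "(\<Prod>j<d. Y z (r j) (v ! j)) =
          (\<Sum>f\<in>F. if map ((!) u) f = v then \<Prod>j<d. (-1) ^ (z ! (f ! j)) else 0)"
        if v: "v \<in> words m d" for v
      proof -
        have "(\<Prod>j<d. Y z (r j) (v ! j)) = (\<Sum>f\<in>words d d. \<Prod>j<d.
            if r (f ! j) = r j \<and> u ! (f ! j) = v ! j then (-1) ^ (z ! (f ! j)) else 0)"
          unfolding Y_def prod_sum_words ..
        also have "\<dots> = (\<Sum>f\<in>words d d. if f \<in> F \<and> map ((!) u) f = v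
            then \<Prod>j<d. (-1) ^ (z ! (f ! j)) else 0)"
        proof (rule sum.cong[OF refl])
          fix f assume f: "f \<in> words d d"
          have "f \<in> F \<and> map ((!) u) f = v \<longleftrightarrow> (\<forall>j<d. r (f ! j) = r j \<and> u ! (f ! j) = v ! j)"
            using f v by (auto simp: F_def list_eq_iff_nth_eq words_def)
          then show "(\<Prod>j<d. if r (f ! j) = r j \<and> u ! (f ! j) = v ! j then (-1) ^ (z ! (f ! j)) else 0) =
            (if f \<in> F \<and> map ((!) u) f = v then \<Prod>j<d. (-1) ^ (z ! (f ! j)) else (0 :: complex))"
            by (auto intro!: prod_zero)
        qed
        also have "\<dots> = (\<Sum>f\<in>F. if map ((!) u) f = v then \<Prod>j<d. (-1) ^ (z ! (f ! j)) else 0)"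
          by (rule sum.mono_neutral_cong_right) (auto simp: F_def)
        finally show ?thesis .
      qed
      have "(\<Sum>v\<in>words m d. (\<Prod>j<d. Y z (r j) (v ! j)) * s v) =
        (\<Sum>v\<in>words m d. \<Sum>f\<in>F. if map ((!) u) f = v then (\<Prod>j<d. (-1) ^ (z ! (f ! j))) * s v else 0)"
        by (auto simp: * sum_distrib_right intro!: sum.cong)
      also have "\<dots> = (\<Sum>f\<in>F. \<Sum>v\<in>words m d. if map ((!) u) f = v then (\<Prod>j<d. (-1) ^ (z ! (f ! j))) * s v else 0)"
        by (rule sum.swap)
      also have "\<dots> = (\<Sum>f\<in>F. (\<Prod>j<d. (-1) ^ (z ! (f ! j))) * s (map ((!) u) f))"
      proof (rule sum.cong[OF refl])
        fix f assume "f \<in> F"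
        then have "map ((!) u) f \<in> words m d"
          using words_nth[OF u] by (auto simp: F_def words_def)
        then show "(\<Sum>v\<in>words m d. if map ((!) u) f = v then (\<Prod>j<d. (-1) ^ (z ! (f ! j))) * s v else 0) =
          (\<Prod>j<d. (-1) ^ (z ! (f ! j))) * s (map ((!) u) f)"
          by simp
      qed
      finally show ?thesis .
    qed
    have signs: "(\<Sum>z\<in>words 2 d. (\<Prod>i<d. (-1) ^ (z ! i)) * (\<Prod>j<d. (-1) ^ (z ! (f ! j)))) =
        (if set f = {..<d} then 2 ^ d else (0 :: complex))" if f: "f \<in> F" for f
    proof -
      have lf: "length f = d" and sf: "set f \<subseteq> {..<d}" using f by (auto simp: F_def words_def)
      have "(\<Prod>j<d. (-1) ^ (z ! (f ! j))) = (\<Prod>i<d. ((-1) ^ (z ! i)) ^ count_list f i :: complex)" for z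
      proof -
        have "(\<Prod>j<d. (-1) ^ (z ! (f ! j)) :: complex) = prod_list (map (\<lambda>i. (-1) ^ (z ! i)) f)"
          by (simp add: prod.list_conv_set_nth lf atLeast0LessThan)
        also have "\<dots> = (\<Prod>i<d. ((-1) ^ (z ! i)) ^ count_list f i)"
          using sf by (subst prod_list_map_eq_prod_count[of _ "{..<d}"]) auto
        finally show ?thesis .
      qed
      then have "(\<Sum>z\<in>words 2 d. (\<Prod>i<d. (-1) ^ (z ! i)) * (\<Prod>j<d. (-1) ^ (z ! (f ! j)))) =
        (\<Sum>z\<in>words 2 d. \<Prod>i<d. ((-1) ^ (z ! i)) ^ Suc (count_list f i) :: complex)"
        by (simp add: prod.distrib)
      \<comment> \<open>The signs are independent, so the sum splits by position. The factor
        \<open>1 - (-1) ^ count\<close> is 0 at a position missed by \<open>f\<close> and 2 at a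
        position hit exactly once.\<close>
      also have "\<dots> = (\<Prod>i<d. \<Sum>e<2. ((-1) ^ e) ^ Suc (count_list f i))"
        by (rule prod_sum_words[symmetric])
      also have "\<dots> = (\<Prod>i<d. 1 - (-1) ^ count_list f i)"
        by (simp add: numeral_2_eq_2)
      also have "\<dots> = (if set f = {..<d} then 2 ^ d else 0)"
      proof (cases "set f = {..<d}")
        case True
        then have "distinct f" using lf by (intro card_distinct) simp
        then have "count_list f i = 1" if "i < d" for i
          using True that distinct_count_atmost_1[of f] by (simp add: count_mset)
        then show ?thesis using True by simp
      next
        case False
        then obtain i where "i < d" "i \<notin> set f" using sf by auto
        then show ?thesis using False by (auto intro!: prod_zero bexI[of _ i] simp: count_list_0_iff)
      qed
      finally show ?thesis .
    qed
    have perm: "s (map ((!) u) f) = s u" if f: "f \<in> F" and sf: "set f = {..<d}" for f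
    proof -
      define p where "p j = (if j < d then f ! j else j)" for j
      have lf: "length f = d" using f by (auto simp: F_def words_def)
      then have "distinct f" using sf by (intro card_distinct) simp
      then have "bij_betw ((!) f) {..<d} {..<d}" using bij_betw_nth[of f] lf sf by blast
      then have "bij_betw p {..<d} {..<d}" by (subst bij_betw_cong[where g = "(!) f"]) (auto simp: p_def)
      then have p: "p permutes {..<d}" by (rule bij_imp_permutes) (auto simp: p_def)
      have "map ((!) u) f = permute_list p u"
        using u lf by (auto simp: list_eq_iff_nth_eq permute_list_def p_def words_def)
      then show ?thesis using sym[OF p _ u] f by (simp add: p_def F_def)
    qed
    \<comment> \<open>The identity word makes the number of surviving \<open>f\<close> positive, so
      the final multiple of \<open>s u\<close> has a nonzero coefficient.\<close>
    have id: "[0..<d] \<in> {f \<in> F. set f = {..<d}}" by (auto simp: F_def words_def)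
    have "0 = (\<Sum>z\<in>words 2 d. (\<Prod>i<d. (-1) ^ (z ! i)) *
        (\<Sum>v\<in>words m d. (\<Prod>j<d. Y z (r j) (v ! j)) * s v))"
      by (simp add: zero)
    also have "\<dots> = (\<Sum>z\<in>words 2 d. \<Sum>f\<in>F. (\<Prod>i<d. (-1) ^ (z ! i)) * (\<Prod>j<d. (-1) ^ (z ! (f ! j))) * s (map ((!) u) f))"
      by (simp add: eval sum_distrib_left mult.assoc)
    also have "\<dots> = (\<Sum>f\<in>F. \<Sum>z\<in>words 2 d. (\<Prod>i<d. (-1) ^ (z ! i)) * (\<Prod>j<d. (-1) ^ (z ! (f ! j))) * s (map ((!) u) f))"
      by (rule sum.swap)
    also have "\<dots> = (\<Sum>f\<in>F. (if set f = {..<d} then 2 ^ d else 0) * s (map ((!) u) f))"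
      by (simp add: signs flip: sum_distrib_right)
    also have "\<dots> = (\<Sum>f\<in>{f \<in> F. set f = {..<d}}. 2 ^ d * s u)"
      using finF by (intro sum.mono_neutral_cong_right) (auto simp: perm)
    also have "\<dots> = of_nat (card {f \<in> F. set f = {..<d}}) * 2 ^ d * s u" by simp
    finally show ?thesis using id finF by (auto simp: card_eq_0_iff)
  qed
qed

section \<open>Row symmetry of elements of the Schur functor\<close>

lemma sum_fun_apply:
  fixes f :: "'a \<Rightarrow> 'b \<Rightarrow> complex"
  shows "(\<Sum>x\<in>X. f x) w = (\<Sum>x\<in>X. f x w)"
  by (induction X rule: infinite_finite_induct) auto

lemma row_group_compose:
  assumes p: "p \<in> row_group lam" and q: "q \<in> row_group lam"
  shows "p \<circ> q \<in> row_group lam"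
proof -
  have pq: "p permutes {..<sum_list lam}" "q permutes {..<sum_list lam}"
    using p q by (simp_all add: row_group_def)
  have "fst (boxes lam ! p (q k)) = fst (boxes lam ! k)" if "k < sum_list lam" for k
  proof -
    have "q k < sum_list lam" using permutes_in_image[OF pq(2), of k] that by simp
    then show ?thesis using p q that unfolding row_group_def by fastforce
  qed
  then show ?thesis using permutes_compose[OF pq(2,1)] by (simp add: row_group_def)
qed

lemma row_group_inv:
  assumes p: "p \<in> row_group lam"
  shows "inv_into UNIV p \<in> row_group lam"
proof -
  have p': "p permutes {..<sum_list lam}" using p by (simp add: row_group_def)
  have "fst (boxes lam ! inv_into UNIV p k) = fst (boxes lam ! k)" if "k < sum_list lam" for k
    using p permutes_in_image[OF permutes_inv[OF p'], of k] permutes_inverses[OF p'] that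
    by (auto simp: row_group_def dest: spec[of _ "inv_into UNIV p k"])
  then show ?thesis using permutes_inv[OF p'] by (simp add: row_group_def)
qed

text \<open>The row symmetrizer is the left factor of the Young symmetrizer, so translation by
  \<open>p\<close> only reindexes the sum over the row group.\<close>

lemma young_symmetrizer_row_invariant:
  assumes p: "p \<in> row_group lam" and w: "length w = sum_list lam"
  shows "young_symmetrizer lam T (permute_list p w) = young_symmetrizer lam T w"
proof -
  let ?f = "\<lambda>p'. \<Sum>q\<in>col_group lam. of_int (sign q) * T (permute_list (p' \<circ> q) w)"
  have perm: "p' permutes {..<sum_list lam}" if "p' \<in> row_group lam" for p'
    using that by (simp add: row_group_def)
  have *: "young_symmetrizer lam T v = (\<Sum>p'\<in>row_group lam. \<Sum>q\<in>col_group lam.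
      of_int (sign q) * T (permute_list (p' \<circ> q) v))" if "length v = sum_list lam" for v
    using that by (simp add: young_symmetrizer_def sum_fun_apply fscale_def permute_tensor_def)
  have "young_symmetrizer lam T (permute_list p w) = (\<Sum>p'\<in>row_group lam. ?f (p \<circ> p'))"
    using w permutes_compose[OF _ perm]
    by (auto simp: * permute_list_compose[symmetric] comp_assoc row_group_def col_group_def intro!: sum.cong)
  also have "\<dots> = (\<Sum>p'\<in>row_group lam. ?f p')"
  proof (rule sum.reindex_bij_witness[where i = "\<lambda>p'. inv_into UNIV p \<circ> p'" and j = "\<lambda>p'. p \<circ> p'"])
    show "inv_into UNIV p \<circ> (p \<circ> p') = p'" "p \<circ> (inv_into UNIV p \<circ> p') = p'" for p'
      unfolding comp_assoc[symmetric] permutes_inv_o[OF perm[OF p]] by simp_all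
  qed (use p row_group_inv[OF p] row_group_compose in auto)
  finally show ?thesis using w by (simp add: *)
qed

text \<open>Row invariance is the symmetry that polarization requires, so one covector
  \<open>Y i\<close> per row, shared by all boxes of that row, suffices to detect a nonzero
  element.\<close>

lemma schur_space_eq_0:
  assumes s: "s \<in> schur_space lam m"
    and zero: "\<And>Y. (\<Sum>u\<in>words m (sum_list lam).
      (\<Prod>j<sum_list lam. Y (fst (boxes lam ! j)) (u ! j)) * s u) = 0"
  shows "s = 0"
proof (rule symmetric_tensor_eq_0[where r = "\<lambda>j. fst (boxes lam ! j)"])
  show "s \<in> tensor_space m (sum_list lam)" using s schur_space_subset by auto
next
  fix p u
  assume "p permutes {..<sum_list lam}" "\<And>j. j < sum_list lam \<Longrightarrow> fst (boxes lam ! p j) = fst (boxes lam ! j)"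
    and u: "u \<in> words m (sum_list lam)"
  then have "p \<in> row_group lam" by (simp add: row_group_def)
  then show "s (permute_list p u) = s u"
    using s u by (auto simp: schur_space_def words_def young_symmetrizer_row_invariant)
qed (rule zero)

lemma length_boxes: "length (boxes lam) = sum_list lam"
  by (simp add: boxes_def length_concat comp_def map_nth)

text \<open>A row with a box has a nonzero part; since parts decrease weakly, so do all rows above
  it, and counting these rows gives the bound.\<close>

lemma fst_boxes_less:
  assumes "sorted_wrt (\<ge>) lam" and j: "j < sum_list lam"
  shows "fst (boxes lam ! j) < length (filter (\<lambda>x. x \<noteq> 0) lam)"
proof -
  let ?i = "fst (boxes lam ! j)"
  have "boxes lam ! j \<in> set (boxes lam)" using j by (simp add: length_boxes)
  then have i: "?i < length lam" "lam ! ?i \<noteq> 0" by (auto simp: boxes_def)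
  have "lam ! i' \<noteq> 0" if "i' \<le> ?i" for i'
    using sorted_wrt_nth_less[OF assms(1), of i' ?i] that i by (cases "i' = ?i") auto
  then have "{..?i} \<subseteq> {i'. i' < length lam \<and> lam ! i' \<noteq> 0}" using i by auto
  from card_mono[OF _ this] show ?thesis by (simp add: length_filter_conv_card)
qed

section \<open>Coordinates, diagonal matrices and basis expansions\<close>

lemma independent_nth_eq_0:
  assumes "distinct bs" "cfun.independent (set bs)"
    and zero: "(\<Sum>n<length bs. fscale (c n) (bs ! n)) = 0" and "n < length bs"
  shows "c n = 0"
proof -
  let ?i = "inv_into {..<length bs} ((!) bs)"
  have bij: "bij_betw ((!) bs) {..<length bs} (set bs)" using assms(1) by (rule bij_betw_nth) auto
  have i: "?i (bs ! n) = n" if "n < length bs" for n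
    using bij that by (auto simp: bij_betw_def intro: inv_into_f_f)
  have "(\<Sum>b\<in>set bs. fscale (c (?i b)) b) = 0"
    using zero by (subst sum.reindex_bij_betw[OF bij, symmetric]) (simp add: i)
  from cfun.independentD[OF assms(2) _ _ this, of "bs ! n"] show ?thesis
    using assms(4) by (simp add: i)
qed

lemma tensor_power_mat_diag:
  assumes w: "w \<in> words m d"
  shows "tensor_power d (mat_diag m f) T w = (\<Prod>j<d. f (w ! j)) * T w"
proof -
  have "(\<Prod>j<d. mat_diag m f $$ (w ! j, u ! j)) = (if u = w then \<Prod>j<d. f (w ! j) else 0)"
    if u: "u \<in> words m d" for u
  proof (cases "u = w")
    case True
    then show ?thesis using words_nth[OF w] by (simp add: mat_diag_def)
  next
    case False
    then obtain j where "j < d" "u ! j \<noteq> w ! j"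
      using u w unfolding words_def by (auto simp: list_eq_iff_nth_eq)
    then show ?thesis using False words_nth[OF w] words_nth[OF u]
      by (auto simp: mat_diag_def intro!: prod_zero bexI[of _ j])
  qed
  then have "tensor_power d (mat_diag m f) T w =
    (\<Sum>u\<in>words m d. (if u = w then \<Prod>j<d. f (w ! j) else 0) * T u)"
    using w by (simp add: tensor_power_def mat_diag_def)
  also have "\<dots> = (\<Sum>u\<in>words m d. if u = w then (\<Prod>j<d. f (w ! j)) * T u else 0)"
    by (intro sum.cong) auto
  finally show ?thesis using w by simp
qed

lemma basis_in_schur_space:
  assumes "ordered_basis bs (schur_space lam m)" "n < length bs"
  shows "bs ! n \<in> schur_space lam m"
  using assms cfun.span_base[of "bs ! n" "set bs"] by (simp add: ordered_basis_def)

lemma tensor_power_nth_basis: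
  assumes bs: "ordered_basis bs (schur_space lam m)" and A: "A \<in> carrier_mat m m"
    and n: "n < length bs"
  shows "tensor_power (sum_list lam) A (bs ! n) =
    (\<Sum>b<length bs. fscale (schur_matrix lam bs A $$ (b, n)) (bs ! b))"
proof -
  let ?x = "tensor_power (sum_list lam) A (bs ! n)"
  have d: "distinct bs" and ind: "cfun.independent (set bs)"
    and sp: "cfun.span (set bs) = schur_space lam m"
    using bs by (auto simp: ordered_basis_def)
  have "?x \<in> cfun.span (set bs)"
    using schur_space_invariant[OF A basis_in_schur_space[OF bs n]] sp by simp
  then have "?x = (\<Sum>b\<in>set bs. fscale (cfun.representation (set bs) ?x b) b)"
    using cfun.sum_representation_eq[OF ind, of ?x "set bs"] by simp
  also have "\<dots> = (\<Sum>b<length bs. fscale (cfun.representation (set bs) ?x (bs ! b)) (bs ! b))"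
    using sum.reindex_bij_betw[OF bij_betw_nth[OF d refl refl],
        of "\<lambda>b. fscale (cfun.representation (set bs) ?x b) b"] by simp
  finally show ?thesis using n by (simp add: schur_matrix_def matrix_wrt_def)
qed

section \<open>The row form and its equivariance\<close>

text \<open>
  The form \<open>F\<close> of the introduction: in the \<open>i\<close>-th factor the rows of the Young diagram
  are assigned the letters \<open>i * l, \<dots>, i * l + l - 1\<close>, so different factors see
  disjoint sets of rows of \<open>A\<close>.
\<close>

definition row_word :: "nat list \<Rightarrow> nat \<Rightarrow> nat \<Rightarrow> nat list" where
  "row_word lam l i = map (\<lambda>j. i * l + fst (boxes lam ! j)) [0..<sum_list lam]"

definition row_form :: "nat list \<Rightarrow> nat \<Rightarrow> tensor list \<Rightarrow> nat \<Rightarrow> tensor \<Rightarrow> complex mat \<Rightarrow> complex" where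
  "row_form lam l bs k t A = (\<Sum>a\<in>words (length bs) k. t a *
     (\<Prod>i<k. tensor_power (sum_list lam) A (bs ! (a ! i)) (row_word lam l i)))"

text \<open>Equivariance: acting on the tensor \<open>t\<close> amounts to moving the argument of
  the form from the identity to \<open>A\<close>. This turns semi-invariance of \<open>t\<close>
  into a functional equation for the form.\<close>

lemma row_form_schur_matrix:
  assumes bs: "ordered_basis bs (schur_space lam m)" and A: "A \<in> carrier_mat m m"
  shows "row_form lam l bs k (tensor_power k (schur_matrix lam bs A) t) (1\<^sub>m m) = row_form lam l bs k t A"
proof -
  let ?N = "length bs" and ?S = "schur_matrix lam bs A"
  let ?e = "\<lambda>b i. (bs ! b) (row_word lam l i)"
  have S: "dim_row ?S = ?N" "dim_col ?S = ?N" by (simp_all add: schur_matrix_def matrix_wrt_def)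
  have one: "tensor_power (sum_list lam) (1\<^sub>m m) (bs ! b) = bs ! b" if "b < ?N" for b
    using basis_in_schur_space[OF bs that] schur_space_subset by (intro tensor_power_one) auto
  have "row_form lam l bs k (tensor_power k ?S t) (1\<^sub>m m) =
    (\<Sum>a\<in>words ?N k. \<Sum>u\<in>words ?N k. t u * (\<Prod>i<k. ?S $$ (a ! i, u ! i) * ?e (a ! i) i))"
    unfolding row_form_def
  proof (rule sum.cong[OF refl])
    fix a assume a: "a \<in> words ?N k"
    then have "(\<Prod>i<k. tensor_power (sum_list lam) (1\<^sub>m m) (bs ! (a ! i)) (row_word lam l i)) =
        (\<Prod>i<k. ?e (a ! i) i)"
      by (intro prod.cong refl) (simp add: one[OF words_nth[OF a]])
    then show "tensor_power k ?S t a * (\<Prod>i<k. tensor_power (sum_list lam) (1\<^sub>m m) (bs ! (a ! i)) (row_word lam l i)) =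
        (\<Sum>u\<in>words ?N k. t u * (\<Prod>i<k. ?S $$ (a ! i, u ! i) * ?e (a ! i) i))"
      using a by (simp add: tensor_power_def[of k ?S] S sum_distrib_left prod.distrib mult_ac)
  qed
  also have "\<dots> = (\<Sum>u\<in>words ?N k. \<Sum>a\<in>words ?N k. t u * (\<Prod>i<k. ?S $$ (a ! i, u ! i) * ?e (a ! i) i))"
    by (rule sum.swap)
  \<comment> \<open>The sum over words factors into one sum per tensor factor; each of these is the
    expansion of \<open>A\<close> applied to a basis vector.\<close>
  also have "\<dots> = (\<Sum>u\<in>words ?N k. t u * (\<Prod>i<k. \<Sum>b<?N. ?S $$ (b, u ! i) * ?e b i))"
    by (simp only: prod_sum_words sum_distrib_left)
  also have "\<dots> = row_form lam l bs k t A"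
    unfolding row_form_def
  proof (rule sum.cong[OF refl])
    fix u assume u: "u \<in> words ?N k"
    have "(\<Prod>i<k. \<Sum>b<?N. ?S $$ (b, u ! i) * ?e b i) =
        (\<Prod>i<k. tensor_power (sum_list lam) A (bs ! (u ! i)) (row_word lam l i))"
      by (intro prod.cong refl)
        (simp add: tensor_power_nth_basis[OF bs A words_nth[OF u]] sum_fun_apply fscale_def)
    then show "t u * (\<Prod>i<k. \<Sum>b<?N. ?S $$ (b, u ! i) * ?e b i) =
        t u * (\<Prod>i<k. tensor_power (sum_list lam) A (bs ! (u ! i)) (row_word lam l i))"
      by simp
  qed
  finally show ?thesis .
qed

lemma row_form_fscale: "row_form lam l bs k (fscale c t) A = c * row_form lam l bs k t A"
  by (simp add: row_form_def fscale_def sum_distrib_left mult.assoc)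

section \<open>Special linear and diagonal matrices\<close>

lemma SL_mult: "A \<in> SL m \<Longrightarrow> B \<in> SL m \<Longrightarrow> A * B \<in> SL m"
  by (auto simp: SL_def det_mult)

lemma SL_right_inverse:
  assumes "A \<in> SL m"
  obtains B where "B \<in> SL m" "A * B = 1\<^sub>m m"
proof -
  have A: "A \<in> carrier_mat m m" "det A = 1" using assms by (auto simp: SL_def)
  then obtain B where B: "B \<in> carrier_mat m m" "A * B = 1\<^sub>m m"
    using det_non_zero_imp_unit[OF A(1)] by (auto simp: Units_def ring_mat_def)
  then have "det B = 1" using det_mult[OF A(1) B(1)] A(2) by simp
  then show thesis using B that by (auto simp: SL_def)
qed

lemma det_mat_diag: "det (mat_diag m f) = (\<Prod>i<m. f i)"
proof -
  have "det (mat_diag m f) = prod_list (diag_mat (mat_diag m f))"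
    by (rule det_upper_triangular[of _ m]) (auto simp: mat_diag_def)
  then show ?thesis by (simp add: prod_list_diag_prod mat_diag_def atLeast0LessThan)
qed

section \<open>The character of a fixed line\<close>

text \<open>These assumptions are to be refuted, for any tensor power \<open>k\<close> with
  \<open>k * l < m\<close>. Only a scalar \<open>chi A\<close> for each \<open>A\<close> is assumed;
  multiplicativity follows from \<open>t\<close> being nonzero.\<close>

locale semi_invariant =
  fixes m l k :: nat and lam :: "nat list" and bs :: "tensor list" and t :: tensor
    and chi :: "complex mat \<Rightarrow> complex"
  assumes sorted: "sorted_wrt (\<ge>) lam"
    and l: "l = length (filter (\<lambda>x. x \<noteq> 0) lam)" "l \<noteq> 0"
    and k: "k \<noteq> 0" "k * l < m"
    and basis: "ordered_basis bs (schur_space lam m)"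
    and t: "t \<in> tensor_space (length bs) k" "t \<noteq> 0"
    and semi: "A \<in> SL m \<Longrightarrow> tensor_power k (schur_matrix lam bs A) t = fscale (chi A) t"
begin

lemma degree_pos: "sum_list lam > 0"
proof -
  have "filter (\<lambda>x. x \<noteq> 0) lam \<noteq> []" using l by auto
  then obtain x where "x \<in> set lam" "x \<noteq> 0" unfolding filter_empty_conv by blast
  then show ?thesis using member_le_sum_list[of x lam] by auto
qed

lemma row_word_words: "i < k \<Longrightarrow> row_word lam l i \<in> words (k * l) (sum_list lam)"
proof -
  assume "i < k"
  have "i * l + fst (boxes lam ! j) < k * l" if "j < sum_list lam" for j
  proof -
    have "i * l + fst (boxes lam ! j) < Suc i * l"
      using fst_boxes_less[OF sorted that] l by simp
    also have "\<dots> \<le> k * l" using \<open>i < k\<close> by (intro mult_right_mono) auto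
    finally show ?thesis .
  qed
  then show ?thesis by (auto simp: row_word_def words_def)
qed

lemma row_word_words_m: "i < k \<Longrightarrow> row_word lam l i \<in> words m (sum_list lam)"
  using row_word_words[of i] k(2) unfolding words_def by (simp add: subset_iff) (meson order_less_trans)

lemma chi_mult:
  assumes A: "A \<in> SL m" and B: "B \<in> SL m"
  shows "chi (A * B) = chi A * chi B"
proof -
  have S: "schur_matrix lam bs X \<in> carrier_mat (length bs) (length bs)" for X
    by (simp add: schur_matrix_def matrix_wrt_def)
  interpret T: Vector_Spaces.linear fscale fscale "tensor_power k (schur_matrix lam bs A)"
    by (rule tensor_power_linear)
  have "fscale (chi (A * B)) t = tensor_power k (schur_matrix lam bs (A * B)) t"
    using semi[OF SL_mult[OF A B]] by simp
  also have "\<dots> = tensor_power k (schur_matrix lam bs A) (tensor_power k (schur_matrix lam bs B) t)"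
    using A B schur_matrix_mult[OF basis, of A B] by (simp add: SL_def tensor_power_mult[OF S S])
  also have "\<dots> = fscale (chi A * chi B) t"
    unfolding semi[OF B] T.scale semi[OF A] cfun.scale_scale by (simp only: mult.commute)
  finally show ?thesis using t(2) by simp
qed

lemma chi_nonzero:
  assumes "A \<in> SL m"
  shows "chi A \<noteq> 0"
proof -
  obtain B where B: "B \<in> SL m" "A * B = 1\<^sub>m m" using SL_right_inverse[OF assms] .
  have "tensor_power k (schur_matrix lam bs (1\<^sub>m m)) t = t"
    using t by (simp add: schur_matrix_one[OF basis] tensor_power_one)
  then have "chi (1\<^sub>m m) = 1"
    using semi[of "1\<^sub>m m"] t(2) cfun.scale_right_imp_eq[of t "chi (1\<^sub>m m)" 1] by (simp add: SL_def)
  then show ?thesis using chi_mult[OF assms B(1)] B(2) by auto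
qed

lemma row_form_SL: "A \<in> SL m \<Longrightarrow> row_form lam l bs k t A = chi A * row_form lam l bs k t (1\<^sub>m m)"
  using row_form_schur_matrix[OF basis, of A l k t] semi[of A] by (simp add: SL_def row_form_fscale)

lemma row_form_mat_diag:
  "row_form lam l bs k t (mat_diag m f) =
    (\<Prod>i<k. \<Prod>j<sum_list lam. f (row_word lam l i ! j)) * row_form lam l bs k t (1\<^sub>m m)"
proof -
  have "tensor_power (sum_list lam) (mat_diag m f) (bs ! b) (row_word lam l i) =
      (\<Prod>j<sum_list lam. f (row_word lam l i ! j)) * tensor_power (sum_list lam) (1\<^sub>m m) (bs ! b) (row_word lam l i)"
    if "i < k" for i b
    \<comment> \<open>The second instance, with constant value 1, evaluates the identity matrix on
      \<open>bs ! b\<close> even if \<open>b\<close> is not a valid index.\<close>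
    using tensor_power_mat_diag[OF row_word_words_m[OF that], of f "bs ! b"]
      tensor_power_mat_diag[OF row_word_words_m[OF that], of "\<lambda>_. 1" "bs ! b"] by simp
  then have "(\<Prod>i<k. tensor_power (sum_list lam) (mat_diag m f) (bs ! (a ! i)) (row_word lam l i)) =
      (\<Prod>i<k. \<Prod>j<sum_list lam. f (row_word lam l i ! j)) *
      (\<Prod>i<k. tensor_power (sum_list lam) (1\<^sub>m m) (bs ! (a ! i)) (row_word lam l i))" for a
    unfolding prod.distrib[symmetric] by (intro prod.cong) simp_all
  then show ?thesis
    unfolding row_form_def sum_distrib_left by (intro sum.cong refl) (simp only: mult.left_commute)
qed

lemma row_form_one: "row_form lam l bs k t (1\<^sub>m m) = 0"
proof (rule ccontr)
  assume nz: "row_form lam l bs k t (1\<^sub>m m) \<noteq> 0"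
  \<comment> \<open>A letter that certainly occurs. It is below \<open>k * l\<close>, hence
    different from the last letter \<open>m - 1\<close>.\<close>
  define z where "z = row_word lam l 0 ! 0"
  have z: "z < m - 1"
    using words_nth[OF row_word_words[of 0] degree_pos] k by (simp add: z_def)
  define D where "D c = mat_diag m (\<lambda>i. if i = z then c else if i = m - 1 then 1 / c else 1)" for c :: complex
  \<comment> \<open>A signed transposition of \<open>z\<close> and \<open>m - 1\<close>: the entry
    -1 corrects the determinant of the swap, and conjugation by \<open>P\<close> exchanges the two
    special entries of \<open>D 2\<close>, giving \<open>D (1 / 2)\<close>.\<close>
  define P :: "complex mat" where "P = mat_diag m (\<lambda>i. if i = z then - 1 else 1) * swaprows_mat m z (m - 1)"
  define e where "e = (\<Sum>i<k. \<Sum>j<sum_list lam. if row_word lam l i ! j = z then 1 else 0 :: nat)"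
  have D_SL: "D c \<in> SL m" if "c \<noteq> 0" for c
  proof -
    have "det (D c) = (\<Prod>i\<in>{z, m - 1}. if i = z then c else if i = m - 1 then 1 / c else 1)"
      unfolding D_def det_mat_diag using z by (intro prod.mono_neutral_right) auto
    then show ?thesis using z that by (simp add: SL_def D_def)
  qed
  have P_SL: "P \<in> SL m"
  proof -
    have "det P = - (if z < m then - 1 else 1)"
      using z unfolding P_def by (subst det_mult[of _ m]) (simp_all add: det_mat_diag det_swaprows_mat)
    moreover have "P \<in> carrier_mat m m"
      unfolding P_def by (rule mult_carrier_mat[of _ m m]) simp_all
    ultimately show ?thesis using z by (simp add: SL_def)
  qed
  have "P * D 2 = D (1 / 2) * P"
    using z unfolding P_def D_def
    by (intro eq_matI) (auto simp: mat_diag_mult_left[of _ m m] mat_diag_mult_right[of _ m m])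
  then have "chi P * chi (D 2) = chi (D (1 / 2)) * chi P"
    using chi_mult[OF P_SL D_SL[of 2]] chi_mult[OF D_SL[of "1 / 2"] P_SL] by auto
  then have chi_D: "chi (D 2) = chi (D (1 / 2))" using chi_nonzero[OF P_SL] by simp
  \<comment> \<open>As the form is nonzero at the identity, the character can be read off from the
    diagonal weight. The entry \<open>1 / c\<close> never contributes because no row word contains
    \<open>m - 1\<close>; \<open>e\<close> counts the occurrences of \<open>z\<close>.\<close>
  have "chi (D c) = c ^ e" if c: "c \<noteq> 0" for c
  proof -
    have "chi (D c) * row_form lam l bs k t (1\<^sub>m m) =
      (\<Prod>i<k. \<Prod>j<sum_list lam. if row_word lam l i ! j = z then c
        else if row_word lam l i ! j = m - 1 then 1 / c else 1) * row_form lam l bs k t (1\<^sub>m m)"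
      using row_form_SL[OF D_SL[OF c], symmetric] unfolding D_def row_form_mat_diag .
    moreover have "(if row_word lam l i ! j = z then c else if row_word lam l i ! j = m - 1 then 1 / c else 1) =
        c ^ (if row_word lam l i ! j = z then 1 else 0)" if "i < k" "j < sum_list lam" for i j
      using words_nth[OF row_word_words[OF that(1)] that(2)] k by auto
    ultimately show ?thesis using nz by (simp add: e_def power_sum)
  qed
  \<comment> \<open>Equality of \<open>2 ^ e\<close> and \<open>(1 / 2) ^ e\<close> forces
    \<open>e = 0\<close>, although \<open>z\<close> occurs.\<close>
  from this[of 2] this[of "1 / 2"] chi_D have "1 = (2 :: complex) ^ e * 2 ^ e"
    by (simp add: power_one_over divide_eq_eq)
  then have "(2 :: complex) ^ (e + e) = 1" by (simp only: power_add)
  then have "(2 :: nat) ^ (e + e) = 1"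
    by (metis of_nat_eq_1_iff of_nat_numeral of_nat_power)
  then have "\<forall>i<k. \<forall>j<sum_list lam. row_word lam l i ! j \<noteq> z" by (auto simp: e_def split: if_splits)
  then show False using k degree_pos unfolding z_def by blast
qed

section \<open>Vanishing of the row form on all matrices\<close>

lemma row_form_cong:
  assumes "A \<in> carrier_mat m m" "B \<in> carrier_mat m m"
    and "\<And>i j. i < k * l \<Longrightarrow> j < m \<Longrightarrow> A $$ (i, j) = B $$ (i, j)"
  shows "row_form lam l bs k t A = row_form lam l bs k t B"
  unfolding row_form_def
proof (intro sum.cong prod.cong refl arg_cong2[where f = "(*)"])
  fix a i assume "i \<in> {..<k}"
  then have "row_word lam l i \<in> words (k * l) (sum_list lam)" by (simp add: row_word_words)
  then show "tensor_power (sum_list lam) A (bs ! (a ! i)) (row_word lam l i) =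
      tensor_power (sum_list lam) B (bs ! (a ! i)) (row_word lam l i)"
    using assms words_nth by (auto simp: tensor_power_def intro!: sum.cong prod.cong)
qed

text \<open>Dividing the last row by the determinant lands in \<open>SL m\<close>. That row has
  index \<open>m - 1\<close>, at least \<open>k * l\<close>, so the form does not see the
  change.\<close>

lemma row_form_invertible:
  assumes A: "A \<in> carrier_mat m m" "det A \<noteq> 0"
  shows "row_form lam l bs k t A = 0"
proof -
  let ?B = "multrow (m - 1) (1 / det A) A"
  have "?B \<in> SL m" using A k by (simp add: SL_def det_multrow[of _ m])
  then have "row_form lam l bs k t ?B = 0" by (simp add: row_form_SL row_form_one)
  moreover have "row_form lam l bs k t A = row_form lam l bs k t ?B"
    using A k by (intro row_form_cong) auto
  ultimately show ?thesis by simp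
qed

text \<open>A density argument along the line of matrices \<open>X - s * 1\<close>: the form is a
  polynomial in \<open>s\<close> that vanishes wherever the matrix is invertible. Multiplying by the
  characteristic polynomial covers the remaining \<open>s\<close>.\<close>

lemma row_form_zero:
  assumes X: "X \<in> carrier_mat m m"
  shows "row_form lam l bs k t X = 0"
proof -
  define p where "p = (\<Sum>a\<in>words (length bs) k. [:t a:] * (\<Prod>i<k. \<Sum>u\<in>words m (sum_list lam).
    (\<Prod>j<sum_list lam. [:X $$ (row_word lam l i ! j, u ! j), if row_word lam l i ! j = u ! j then - 1 else 0:]) *
    [:(bs ! (a ! i)) u:]))"
  have p: "row_form lam l bs k t (char_matrix X s) = poly p s" for s
    unfolding row_form_def p_def poly_sum poly_mult poly_prod
  proof (intro sum.cong refl arg_cong2[where f = "(*)"] prod.cong)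
    fix a i assume "i \<in> {..<k}"
    then have w: "row_word lam l i \<in> words m (sum_list lam)" by (simp add: row_word_words_m)
    show "tensor_power (sum_list lam) (char_matrix X s) (bs ! (a ! i)) (row_word lam l i) =
      (\<Sum>u\<in>words m (sum_list lam). (\<Prod>j<sum_list lam.
        poly [:X $$ (row_word lam l i ! j, u ! j), if row_word lam l i ! j = u ! j then - 1 else 0:] s) *
        poly [:(bs ! (a ! i)) u:] s)"
      using w words_nth X
      by (auto simp: tensor_power_def char_matrix_def intro!: sum.cong prod.cong)
  qed simp_all
  have "poly (p * char_poly X) s = 0" for s
  proof (cases "det (char_matrix X s) = 0")
    case True
    then show ?thesis using X by (simp add: eigenvalue_det[symmetric] eigenvalue_root_char_poly)
  next
    case False
    then show ?thesis using X row_form_invertible[of "char_matrix X s"] by (simp add: p)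
  qed
  then have "p * char_poly X = 0" using poly_all_0_iff_0 by blast
  moreover have "char_poly X \<noteq> 0"
    using degree_monic_char_poly[OF X] by auto
  ultimately have "p = 0" by simp
  moreover have "char_matrix X 0 = X" using X by (intro eq_matI) (auto simp: char_matrix_def)
  ultimately show ?thesis using p[of 0] by simp
qed

section \<open>Recovering the tensor from its row form\<close>

lemma no_semi_invariant: False
proof -
  let ?d = "sum_list lam"
  define ev where "ev Y s = (\<Sum>u\<in>words m ?d. (\<Prod>j<?d. Y (fst (boxes lam ! j)) (u ! j)) * s u)"
    for Y :: "nat \<Rightarrow> nat \<Rightarrow> complex" and s :: tensor
  have "t a = 0" if a: "a \<in> words (length bs) k" for a
  \<comment> \<open>\<open>E\<close> holds the value vectors of the whole basis at each choice of
    covectors. A linear form vanishing on \<open>E\<close> is an element of the Schur functor on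
    which all evaluations vanish, hence 0.\<close>
  proof (rule multilinear_separation[where E = "range (\<lambda>Y n. ev Y (bs ! n))", OF _ _ _ a])
    fix c n
    assume zero: "\<And>x. x \<in> range (\<lambda>Y n. ev Y (bs ! n)) \<Longrightarrow> (\<Sum>n<length bs. c n * x n) = 0"
      and n: "n < length bs"
    let ?s = "\<Sum>n<length bs. fscale (c n) (bs ! n)"
    have "?s = 0"
    proof (rule schur_space_eq_0)
      have "?s \<in> cfun.span (set bs)"
        by (intro cfun.span_sum cfun.span_scale cfun.span_base) auto
      then show "?s \<in> schur_space lam m" using basis by (simp add: ordered_basis_def)
    next
      fix Y
      have "ev Y ?s = (\<Sum>n<length bs. c n * ev Y (bs ! n))"
        unfolding ev_def sum_fun_apply fscale_def sum_distrib_left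
        by (subst sum.swap) (simp add: mult_ac)
      also have "\<dots> = 0" by (rule zero) auto
      finally show "(\<Sum>u\<in>words m ?d. (\<Prod>j<?d. Y (fst (boxes lam ! j)) (u ! j)) * ?s u) = 0"
        by (simp only: ev_def)
    qed
    then show "c n = 0" using basis n by (auto simp: ordered_basis_def intro: independent_nth_eq_0)
  next
    fix x :: "nat \<Rightarrow> nat \<Rightarrow> complex"
    assume "\<And>i. x i \<in> range (\<lambda>Y n. ev Y (bs ! n))"
    then have "\<forall>i. \<exists>Y. x i = (\<lambda>n. ev Y (bs ! n))" by auto
    then obtain Y where x: "\<And>i. x i = (\<lambda>n. ev (Y i) (bs ! n))" by metis
    \<comment> \<open>The covectors of the \<open>k\<close> factors are stacked in blocks of
      \<open>l\<close> rows, so they can be chosen independently; \<open>k * l < m\<close> leaves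
      room for all of them.\<close>
    define X where "X = mat m m (\<lambda>(i, j). Y (i div l) (i mod l) j)"
    have "tensor_power ?d X s (row_word lam l i) = ev (Y i) s" if i: "i < k" for i s
    proof -
      have w: "row_word lam l i \<in> words m ?d" by (rule row_word_words_m[OF i])
      have "X $$ (row_word lam l i ! j, c) = Y i (fst (boxes lam ! j)) c" if "j < ?d" "c < m" for j c
        using words_nth[OF w that(1)] fst_boxes_less[OF sorted that(1)] l that
        by (simp add: X_def row_word_def)
      then show ?thesis using w words_nth
        by (auto simp: tensor_power_def ev_def X_def intro!: sum.cong prod.cong)
    qed
    then show "(\<Sum>a\<in>words (length bs) k. t a * (\<Prod>i<k. x i (a ! i))) = 0"
      using row_form_zero[of X] by (simp add: row_form_def x X_def)
  qed auto
  then have "t = 0" using t(1) by (fastforce simp: tensor_space_def)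
  then show False using t(2) by simp
qed

end

section \<open>From an invariant line to a spanning tensor\<close>

theorem theorem2p1:
  fixes m l N :: nat and lam :: "nat list" and bs :: "tensor list" and G :: "complex mat set"
  assumes "m \<ge> 1"
    and "length lam = m" and "sorted_wrt (\<ge>) lam"
    and "l = length (filter (\<lambda>x. x \<noteq> 0) lam)" and "l \<ge> 1"
    and "N = cfun.dim (schur_space lam m)"
    and "ordered_basis bs (schur_space lam m)"
    and "G = schur_matrix lam bs ` SL m"
    and "m > 3 * l"
  shows "\<not> detects (tensor_power 3) (tensor_space N 3) G"
proof
  assume "detects (tensor_power 3) (tensor_space N 3) G"
  then obtain L where L: "L \<subseteq> tensor_space N 3" "cfun.subspace L" "cfun.dim L = 1"
    and inv: "\<And>g. g \<in> G \<Longrightarrow> tensor_power 3 g ` L \<subseteq> L"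
    by (auto simp: detects_def)
  obtain B where B: "B \<subseteq> L" "cfun.independent B" "L \<subseteq> cfun.span B" "card B = cfun.dim L"
    using cfun.basis_exists .
  then obtain t where "B = {t}" using L(3) by (auto simp: card_1_singleton_iff)
  with B have t: "t \<in> L" "t \<noteq> 0" "L \<subseteq> cfun.span {t}" by auto
  have "\<exists>c. tensor_power 3 (schur_matrix lam bs A) t = fscale c t" if "A \<in> SL m" for A
  proof -
    have "tensor_power 3 (schur_matrix lam bs A) t \<in> cfun.span {t}"
      using inv[of "schur_matrix lam bs A"] that assms(8) t by auto
    then show ?thesis by (auto simp: cfun.span_singleton)
  qed
  then obtain chi where "\<And>A. A \<in> SL m \<Longrightarrow> tensor_power 3 (schur_matrix lam bs A) t = fscale (chi A) t"
    by metis
  \<comment> \<open>The bound \<open>m > 3 * l\<close> becomes \<open>k * l < m\<close>, and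
    \<open>length_ordered_basis\<close> identifies \<open>N\<close> with
    \<open>length bs\<close>.\<close>
  then interpret semi_invariant m l 3 lam bs t chi
    using assms t L length_ordered_basis[OF assms(7)] by unfold_locales auto
  show False by (rule no_semi_invariant)
qed

end
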